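(* Let $T>0$ and $\psi\in\left(0,\frac{\pi}{2}\right]$. Define $$f(z)=\frac{T\sin\psi}{\pi}\int_0^{z/T} t^{\frac{\psi}{\pi}-1}(1-t)^{-\frac{\psi}{\pi}}\,\mathrm{d}t,\qquad g(z)=T\sin^2\left(\frac{\pi z}{2T}\right),\qquad h=f\circ g,$$ and let $w(z)=\frac{1}{T}\operatorname{Re}\left(h^{-1}(z)\right)$ be the associated harmonic function on the strip $\mathcal{S}_\psi=\{t+r\mathrm{e}^{\pm i\psi} : 0\le t\le T,\ r\ge 0\}$. Then $$w(t)\ \ge\ \frac{2}{\pi}\left(\frac{\psi}{\sin\psi}\right)^{\frac{\pi}{2\psi}}\left(\frac{t}{T}\right)^{\frac{\pi}{2\psi}}\qquad\text{for all } 0<t\le T.$$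
   Context: The function $w$ is bounded and continuous on $\mathcal{S}_\psi$, harmonic in its interior, and satisfies $0=w(0)\le w(t)<w(T)=1$ for $0\le t<T$. For real arguments, $h$ restricts to an increasing bijection of $[0,T]$ onto $[0,T]$, and for $t\in[0,T]$ the number $h^{-1}(t)\in[0,T]$ is the inverse of this restriction, so that $w(t)=h^{-1}(t)/T$. *)

theory Defs
  imports "HOL-Complex_Analysis.Complex_Analysis"
begin

definition skew_strip :: "real \<Rightarrow> real \<Rightarrow> complex set" where
  "skew_strip T \<psi> =
     {of_real t + of_real r * cis \<theta> | t r \<theta>. 0 \<le> t \<and> t \<le> T \<and> 0 \<le> r \<and> \<theta> \<in> {\<psi>, - \<psi>}}"

(* The integrand is holomorphic off the two cuts {..0} and {1..}, whose complement is simply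
   connected, so integrating along the segment is no restriction. All powers are principal.
   The integral is improper at 0, and also at 1 when z = T; the Henstock-Kurzweil integral
   underlying contour_integral covers both singularities. *)
definition f_map :: "real \<Rightarrow> real \<Rightarrow> complex \<Rightarrow> complex" where
  "f_map T \<psi> z = of_real (T * sin \<psi> / pi) *
     contour_integral (linepath 0 (z / of_real T))
       (\<lambda>t. t powr of_real (\<psi> / pi - 1) * (1 - t) powr of_real (- \<psi> / pi))"

definition g_map :: "real \<Rightarrow> complex \<Rightarrow> complex" where
  "g_map T z = of_real T * (sin (of_real pi * z / (2 * of_real T)))\<^sup>2"

definition h_map :: "real \<Rightarrow> real \<Rightarrow> complex \<Rightarrow> complex" where
  "h_map T \<psi> = f_map T \<psi> \<circ> g_map T"

definition vert_strip :: "real \<Rightarrow> complex set" where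
  "vert_strip T = {z. 0 < Re z \<and> Re z < T}"

(* The map h takes the open vertical strip conformally onto the interior of the skew strip,
   and it fixes the corners 0 and T. The other boundary lines of the vertical strip are sent
   by g into the branch cuts of f, so on the remaining boundary points of the skew strip the
   inverse is taken to be its continuous extension from the interior. Values outside the
   skew strip are irrelevant. *)
definition h_inv :: "real \<Rightarrow> real \<Rightarrow> complex \<Rightarrow> complex" where
  "h_inv T \<psi> z =
     (if z \<in> h_map T \<psi> ` (vert_strip T \<union> {0, of_real T})
      then inv_into (vert_strip T \<union> {0, of_real T}) (h_map T \<psi>) z
      else Lim (at z within interior (skew_strip T \<psi>)) (inv_into (vert_strip T) (h_map T \<psi>)))"

definition w_fun :: "real \<Rightarrow> real \<Rightarrow> complex \<Rightarrow> real" where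
  "w_fun T \<psi> z = Re (h_inv T \<psi> z) / T"

end

(* The map f sends nonreal points to nonreal points, so h^{-1}(t) is a real x in [0,T] and it
   remains to bound h(x) from above. With p = pi x / (2T) and a = psi / pi, substituting
   (sin p)^2 in the integral gives (psi / sin psi) h(x) / T = 2a * int_0^p tan(q) powr (2a-1) dq,
   and tan q >= q bounds this by p powr (2a). *)
theory Submission
  imports Defs
begin

section \<open>Nonreal endpoints of the Beta integral\<close>

text \<open>The product of powers has argument \<open>a * (Arg w - Arg (1 - x * w))\<close>. Since
  \<open>Im (1 - x * w) = - x * Im w\<close>, the two arguments never share a sign, so their
  difference has the sign of \<open>Im w\<close> and modulus below \<open>2 * pi\<close>. The bound
  \<open>a \<le> 1/2\<close> then keeps the sine away from its next zero.\<close>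

lemma Im_powr_ratio_sign:
  fixes w :: complex and a x :: real
  assumes a: "0 < a" "a \<le> 1/2" and x: "0 \<le> x" and w: "Im w \<noteq> 0"
  shows "0 < Im w * Im (w powr of_real a * (1 - of_real x * w) powr of_real (- a))"
proof -
  define v where "v = 1 - of_real x * w"
  define d where "d = Im (ln w) - Im (ln v)"
  have w0: "w \<noteq> 0" using w by auto
  have v0: "v \<noteq> 0"
  proof
    assume "v = 0"
    then have "Im v = 0" "Re v = 0" by simp_all
    then show False using w by (auto simp: v_def)
  qed
  have Imv: "Im v = - (x * Im w)" by (simp add: v_def)
  \<comment> \<open>A real \<open>v\<close> forces \<open>x = 0\<close> and hence
    \<open>v = 1\<close>. Staying off the cut makes the upper bound \<open>Im (ln v) < pi\<close>
    strict.\<close>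
  have v_slit: "\<not> (Im v = 0 \<and> Re v < 0)" using w by (auto simp: v_def)
  have bounds: "-pi < Im (ln w)" "Im (ln w) \<le> pi" "-pi < Im (ln v)" "Im (ln v) < pi"
    using mpi_less_Im_Ln Im_Ln_le_pi Im_Ln_eq_pi[OF v0] v_slit w0 v0 by (force simp: less_le)+
  have sgn_w: "0 < Im (ln w) \<longleftrightarrow> 0 < Im w" "Im (ln w) < 0 \<longleftrightarrow> Im w < 0"
    using Im_Ln_pos_le[OF w0] Im_Ln_eq_0[OF w0] Im_Ln_le_pi[OF w0] Im_Ln_eq_pi[OF w0] w
    by linarith+
  have sgn_v: "0 < Im v \<Longrightarrow> 0 < Im (ln v)" "Im v < 0 \<Longrightarrow> Im (ln v) < 0"
    using Im_Ln_pos_le[OF v0] Im_Ln_pos_lt_imp[of v] bounds by linarith+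
  moreover have "Im (ln v) = 0" if "Im v = 0"
  proof -
    have "v = 1" using that w by (auto simp: v_def)
    then show ?thesis by simp
  qed
  ultimately have sgn_v: "0 \<le> Im v \<Longrightarrow> 0 \<le> Im (ln v)" "Im v \<le> 0 \<Longrightarrow> Im (ln v) \<le> 0"
    by (auto simp: le_less)
  have sin_sign: "0 < Im w * sin (a * d)"
  proof (cases "0 < Im w")
    case True
    then have "Im v \<le> 0" using x Imv by simp
    then have "0 < d" "d < 2 * pi" using sgn_v sgn_w True bounds by (auto simp: d_def)
    then have "0 < a * d" "a * d < pi"
      using a mult_right_mono[of a "1/2" d] by (simp, linarith)
    then show ?thesis using True by (simp add: sin_gt_zero)
  next
    case False
    then have neg: "Im w < 0" using w by simp
    then have "0 \<le> Im v" using x Imv by (simp add: mult_nonneg_nonpos)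
    then have "0 < - d" "- d < 2 * pi" using sgn_v sgn_w neg bounds by (auto simp: d_def)
    then have "0 < a * (- d)" "a * (- d) < pi"
      using a mult_right_mono[of a "1/2" "- d"] by (simp add: mult_pos_neg, linarith)
    then have "0 < sin (a * (- d))" by (rule sin_gt_zero)
    then show ?thesis using neg by (simp add: mult_neg_neg)
  qed
  have "w powr of_real a * v powr of_real (- a) = exp (of_real a * (ln w - ln v))"
    using w0 v0 by (simp add: powr_def exp_add[symmetric] algebra_simps)
  then have eq: "Im (w powr of_real a * v powr of_real (- a)) = exp (a * (Re (ln w) - Re (ln v))) * sin (a * d)"
    by (simp add: Im_exp d_def)
  show ?thesis
    unfolding v_def[symmetric] eq using sin_sign by (simp add: zero_less_mult_iff mult_less_0_iff)
qed

(* Along the segment from 0 to w the integrand times dz has argument a (Arg w - Arg (1 - x w)),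
   which lies strictly between 0 and pi if w is in the upper half plane. *)
lemma Im_contour_integral_incomplete_beta:
  fixes w :: complex and a :: real
  assumes a: "0 < a" "a \<le> 1/2" and w: "Im w \<noteq> 0"
  shows "Im (contour_integral (linepath 0 w)
           (\<lambda>t. t powr of_real (a - 1) * (1 - t) powr of_real (- a))) \<noteq> 0"
proof -
  define F where "F = (\<lambda>t::complex. t powr of_real (a - 1) * (1 - t) powr of_real (- a))"
  \<comment> \<open>Substituting \<open>t = x * w\<close> splits the integrand times
    \<open>dz\<close> into the real singular weight \<open>x powr (a - 1)\<close> and the factor
    \<open>K\<close>, which is continuous because \<open>1 - x * w\<close> avoids the cut.\<close>
  define K where "K = (\<lambda>x::real. w powr of_real a * (1 - of_real x * w) powr of_real (- a))"
  define J where "J = (\<lambda>x. of_real (x powr (a - 1)) * K x)"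
  have w0: "w \<noteq> 0" using w by auto
  have contK: "continuous_on {0..1} K"
    unfolding K_def by (intro continuous_intros) (use w in \<open>auto simp: complex_eq_iff\<close>)
  have J_eq: "F (linepath 0 w x) * (w - 0) = J x" if "x \<in> {0..1}" for x
  proof -
    have "(of_real x * w) powr of_real (a - 1) = of_real (x powr (a - 1)) * w powr of_real (a - 1)"
      using that by (subst powr_times_real_left) (auto simp: powr_of_real simp del: of_real_diff)
    moreover have "w powr of_real (a - 1) * w = w powr of_real a"
      using w0 by (simp add: powr_diff)
    ultimately show ?thesis
      by (simp add: F_def J_def K_def linepath_def scaleR_conv_of_real mult_ac)
  qed
  have "(\<lambda>x. x powr (a - 1)) absolutely_integrable_on {0..1::real}"
    using has_integral_powr_from_0[of "a - 1" 1] a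
    by (intro nonnegative_absolutely_integrable_1) auto
  then have "(\<lambda>x. complex_of_real (x powr (a - 1))) absolutely_integrable_on {0..1::real}"
    by (rule absolutely_integrable_linear[of _ _ complex_of_real, unfolded o_def])
       (rule bounded_linear_of_real)
  then have "(\<lambda>x. K x * complex_of_real (x powr (a - 1))) absolutely_integrable_on {0..1}"
    by (intro absolutely_integrable_bounded_measurable_product[OF bilinear_times])
       (auto intro!: continuous_imp_measurable_on_sets_lebesgue compact_imp_bounded
          compact_continuous_image contK)
  then have intJ: "J integrable_on {0..1}"
    by (auto simp: J_def mult.commute dest: set_lebesgue_integral_eq_integral(1))
  have "((\<lambda>x. F (linepath 0 w x) * (w - 0)) has_integral integral {0..1} J) {0..1}"
    using integrable_integral[OF intJ] by (rule has_integral_eq[rotated]) (rule J_eq[symmetric])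
  then have ci: "contour_integral (linepath 0 w) F = integral {0..1} J"
    by (intro contour_integral_unique) (simp add: has_contour_integral_linepath)
  \<comment> \<open>Multiplying by \<open>Im w\<close> treats both half planes at once.\<close>
  define \<phi> where "\<phi> = (\<lambda>x. Im w * Im (K x))"
  have \<phi>_pos: "0 < \<phi> x" if "0 \<le> x" for x
    using Im_powr_ratio_sign[OF a that w] by (simp add: \<phi>_def K_def)
  have cont: "continuous_on {0..1} (\<lambda>x. x * \<phi> x)"
    unfolding \<phi>_def by (intro continuous_intros contK)
  have ImJ: "((\<lambda>x. x powr (a - 1) * \<phi> x) has_integral Im w * Im (integral {0..1} J)) {0..1}"
    using has_integral_mult_right[OF has_integral_Im[OF integrable_integral[OF intJ]], of "Im w"]
    by (simp add: J_def \<phi>_def mult.left_commute)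
  \<comment> \<open>Strict positivity comes from a continuous minorant. The weight \<open>x\<close>
    rather than \<open>1\<close> is chosen because \<open>0 powr (a - 1) = 0\<close>, so that the
    comparison holds at the endpoint \<open>0\<close> too.\<close>
  have "0 < integral {0..1} (\<lambda>x. x * \<phi> x)"
    using integral_less_real[of 0 1 "\<lambda>_. 0" "\<lambda>x. x * \<phi> x"] cont \<phi>_pos by simp
  also have "\<dots> \<le> Im w * Im (integral {0..1} J)"
  proof (rule has_integral_le[OF integrable_integral ImJ])
    show "(\<lambda>x. x * \<phi> x) integrable_on {0..1}"
      using cont by (rule integrable_continuous_real)
    fix x :: real assume x: "x \<in> {0..1}"
    have "x powr 1 \<le> x powr (a - 1)" if "x \<noteq> 0"
      using x a that by (intro powr_mono') auto
    then have "x \<le> x powr (a - 1)" using x by (cases "x = 0") auto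
    then show "x * \<phi> x \<le> x powr (a - 1) * \<phi> x"
      using \<phi>_pos[of x] x by (intro mult_right_mono) auto
  qed
  finally show ?thesis unfolding F_def[symmetric] ci by auto
qed

section \<open>The real incomplete Beta function\<close>

text \<open>This is the unnormalised function \<open>B(s; a, 1 - a)\<close>.\<close>

definition incomplete_beta :: "real \<Rightarrow> real \<Rightarrow> real" where
  "incomplete_beta a s = integral {0..s} (\<lambda>t. t powr (a - 1) * (1 - t) powr (- a))"

text \<open>Euler's reflection formula evaluates \<open>Beta a (1 - a)\<close>. The lemma also
  supplies the integrability behind the continuity and differentiability of
  \<open>incomplete_beta\<close>.\<close>

lemma has_integral_Beta_reflection:
  fixes a :: real
  assumes "0 < a" "a < 1"
  shows "((\<lambda>t. t powr (a - 1) * (1 - t) powr (- a)) has_integral pi / sin (pi * a)) {0..1}"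
proof -
  have "complex_of_real (Gamma a * Gamma (1 - a)) = complex_of_real (pi / sin (pi * a))"
    using Gamma_reflection_complex[of "of_real a"]
    by (simp flip: Gamma_complex_of_real sin_of_real)
  then have "Beta a (1 - a) = pi / sin (pi * a)"
    unfolding of_real_eq_iff by (simp add: Beta_def)
  then show ?thesis using has_integral_Beta_real[of a "1 - a"] assms by simp
qed

lemma incomplete_beta_0 [simp]: "incomplete_beta a 0 = 0"
  by (simp add: incomplete_beta_def)

lemma incomplete_beta_1:
  "0 < a \<Longrightarrow> a < 1 \<Longrightarrow> incomplete_beta a 1 = pi / sin (pi * a)"
  unfolding incomplete_beta_def by (intro integral_unique has_integral_Beta_reflection)

lemma continuous_on_incomplete_beta:
  assumes "0 < a" "a < 1"
  shows "continuous_on {0..1} (incomplete_beta a)"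
  unfolding incomplete_beta_def
  by (rule indefinite_integral_continuous_1, rule has_integral_integrable,
      rule has_integral_Beta_reflection[OF assms])

lemma has_real_derivative_incomplete_beta:
  assumes a: "0 < a" "a < 1" and s: "0 < s" "s < 1"
  shows "(incomplete_beta a has_real_derivative s powr (a - 1) * (1 - s) powr (- a)) (at s)"
proof -
  have "isCont (\<lambda>t. t powr (a - 1) * (1 - t) powr (- a)) s"
    by (intro continuous_intros) (use s in auto)
  then have "((\<lambda>s. integral {0..s} (\<lambda>t. t powr (a - 1) * (1 - t) powr (- a)))
      has_vector_derivative s powr (a - 1) * (1 - s) powr (- a)) (at s within {0..1} - {})"
    using s by (intro integral_has_vector_derivative_continuous_at
        [OF has_integral_integrable[OF has_integral_Beta_reflection[OF a]]])
      (auto intro: continuous_at_imp_continuous_at_within)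
  then show ?thesis
    using s by (simp add: incomplete_beta_def[abs_def] has_real_derivative_iff_has_vector_derivative at_within_Icc_at)
qed

text \<open>On the segment both bases are nonnegative reals, so the principal powers are real
  powers. The case \<open>s = 0\<close> is a constant path.\<close>

lemma contour_integral_incomplete_beta:
  assumes a: "0 < a" "a < 1" and s: "0 \<le> s" "s \<le> 1"
  shows "contour_integral (linepath 0 (of_real s))
           (\<lambda>t. t powr of_real (a - 1) * (1 - t) powr of_real (- a)) = of_real (incomplete_beta a s)"
proof (cases "s = 0")
  case False
  have "(\<lambda>t. t powr (a - 1) * (1 - t) powr (- a)) integrable_on {0..s}"
    by (rule integrable_on_subinterval[OF has_integral_integrable[OF has_integral_Beta_reflection[OF a]]])
       (use s in auto)
  then have "((\<lambda>t. complex_of_real (t powr (a - 1) * (1 - t) powr (- a)))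
               has_integral of_real (incomplete_beta a s)) {0..s}"
    unfolding incomplete_beta_def by (intro has_integral_of_real integrable_integral)
  then have "((\<lambda>t. complex_of_real t powr of_real (a - 1) * (1 - of_real t) powr of_real (- a))
               has_integral of_real (incomplete_beta a s)) {0..s}"
  proof (rule has_integral_eq[rotated])
    fix t assume t: "t \<in> {0..s}"
    have "(1 - complex_of_real t) powr of_real (- a) = of_real ((1 - t) powr (- a))"
      using powr_of_real[of "1 - t" "- a"] s t by simp
    moreover have "complex_of_real t powr of_real (a - 1) = of_real (t powr (a - 1))"
      using t by (intro powr_of_real) auto
    ultimately show "complex_of_real (t powr (a - 1) * (1 - t) powr (- a)) =
        complex_of_real t powr of_real (a - 1) * (1 - of_real t) powr of_real (- a)"
      by simp
  qed
  then show ?thesis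
    using s False
    by (intro contour_integral_unique) (subst has_contour_integral_linepath_Reals_iff; simp)
qed simp

text \<open>Both sides vanish at \<open>p = 0\<close>, and their derivatives are
  \<open>2 * a * tan p powr (2 * a - 1)\<close> and \<open>2 * a * p powr (2 * a - 1)\<close>. As
  \<open>2 * a - 1 \<le> 0\<close>, the estimate \<open>p \<le> tan p\<close> is reversed by the
  power.\<close>

lemma incomplete_beta_sin_squared_le:
  assumes a: "0 < a" "a \<le> 1/2" and p: "0 \<le> p" "p \<le> pi / 2"
  shows "a * incomplete_beta a ((sin p)\<^sup>2) \<le> p powr (2 * a)"
proof -
  define D where "D = (\<lambda>q. q powr (2 * a) - a * incomplete_beta a ((sin q)\<^sup>2))"
  have "D 0 \<le> D p"
  \<comment> \<open>Derivatives are required only in the open interval, which avoids the singular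
    endpoints \<open>0\<close> and \<open>pi / 2\<close>.\<close>
  proof (rule DERIV_nonneg_imp_increasing_open[OF p(1)])
    have "continuous_on {0..p} (\<lambda>q. incomplete_beta a ((sin q)\<^sup>2))"
      by (rule continuous_on_compose2[OF continuous_on_incomplete_beta])
         (use a in \<open>auto intro!: continuous_intros simp: abs_square_le_1\<close>)
    then show "continuous_on {0..p} D"
      unfolding D_def using a by (intro continuous_on_diff continuous_on_powr' continuous_intros) auto
  next
    fix q assume q: "0 < q" "q < p"
    have sc: "0 < sin q" "0 < cos q"
      using q p by (auto intro!: sin_gt_zero cos_gt_zero)
    have s2: "0 < (sin q)\<^sup>2" "(sin q)\<^sup>2 < 1" "1 - (sin q)\<^sup>2 = (cos q)\<^sup>2"
      using sc by (simp, simp add: sin_squared_eq, simp add: cos_squared_eq)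
    have "((\<lambda>q. incomplete_beta a ((sin q)\<^sup>2)) has_real_derivative
        ((sin q)\<^sup>2) powr (a - 1) * (1 - (sin q)\<^sup>2) powr (- a) * (2 * sin q * cos q)) (at q)"
      by (rule DERIV_chain2[OF has_real_derivative_incomplete_beta])
         (use a s2 in \<open>auto intro!: derivative_eq_intros\<close>)
    from DERIV_diff[OF has_real_derivative_powr[OF q(1), of "2 * a"] DERIV_cmult[OF this, of a]]
    have D': "(D has_real_derivative 2 * a * q powr (2 * a - 1) - a * (((sin q)\<^sup>2) powr (a - 1) *
        (1 - (sin q)\<^sup>2) powr (- a) * (2 * sin q * cos q))) (at q)"
      by (simp add: D_def)
    have "((sin q)\<^sup>2) powr (a - 1) * (1 - (sin q)\<^sup>2) powr (- a) * (sin q * cos q) =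
          tan q powr (2 * a - 1)"
    proof -
      have "((sin q)\<^sup>2) powr (a - 1) * sin q = sin q powr (2 * a - 1)"
        using sc powr_add[of "sin q" "2 * (a - 1)" 1] by (simp add: powr_powr flip: powr_numeral)
      moreover have "((cos q)\<^sup>2) powr (- a) * cos q = cos q powr (- (2 * a - 1))"
        using sc powr_add[of "cos q" "2 * (- a)" 1] by (simp add: powr_powr flip: powr_numeral)
      ultimately have "((sin q)\<^sup>2) powr (a - 1) * (1 - (sin q)\<^sup>2) powr (- a) * (sin q * cos q) =
          sin q powr (2 * a - 1) * cos q powr (- (2 * a - 1))"
        unfolding s2(3) by (metis mult.assoc mult.left_commute)
      also have "\<dots> = tan q powr (2 * a - 1)"
        unfolding tan_def using sc
        by (subst powr_divide) (auto simp: powr_minus_divide divide_simps simp flip: powr_add)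
      finally show ?thesis .
    qed
    moreover have "tan q powr (2 * a - 1) \<le> q powr (2 * a - 1)"
    proof -
      have "q \<le> tan q"
        using q p abs_tan_ge[of q] tan_gt_zero[of q] by simp
      then show ?thesis
        using q a by (intro powr_mono2') auto
    qed
    ultimately have "0 \<le> 2 * a * q powr (2 * a - 1) - a * (((sin q)\<^sup>2) powr (a - 1) *
        (1 - (sin q)\<^sup>2) powr (- a) * (2 * sin q * cos q))"
      using a by (simp add: algebra_simps)
    then show "\<exists>y. (D has_real_derivative y) (at q) \<and> 0 \<le> y"
      using D' by blast
  qed
  then show ?thesis using a by (simp add: D_def)
qed

section \<open>The map h at real points and its real values\<close>

lemma h_map_of_real:
  assumes T: "T > 0" and \<psi>: "0 < \<psi>" "\<psi> < pi"
  shows "h_map T \<psi> (of_real x) =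
    of_real (T * sin \<psi> / pi * incomplete_beta (\<psi> / pi) ((sin (pi * x / (2 * T)))\<^sup>2))"
proof -
  define s where "s = (sin (pi * x / (2 * T)))\<^sup>2"
  have "g_map T (of_real x) / of_real T = of_real s"
    using T by (simp add: g_map_def s_def flip: sin_of_real)
  moreover have "s \<le> 1" "0 \<le> s" by (auto simp: s_def abs_square_le_1)
  ultimately show ?thesis
    using contour_integral_incomplete_beta[of "\<psi> / pi" s] \<psi>
    by (simp add: h_map_def f_map_def flip: s_def)
qed

text \<open>Since \<open>inv_into\<close> merely selects some preimage, this is what forces the one
  selected for a real value to be real. With \<open>v = pi * z / T\<close>, the imaginary part of
  \<open>(sin (v / 2))\<^sup>2\<close> is \<open>sin (Re v) * sinh (Im v) / 2\<close>, and
  \<open>0 < Re v < pi\<close>. So \<open>g_map\<close> keeps nonreal points of the strip nonreal,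
  and the Beta integral does the same.\<close>

lemma h_map_real_imp_real:
  assumes T: "T > 0" and \<psi>: "0 < \<psi>" "\<psi> \<le> pi / 2"
    and z: "z \<in> vert_strip T" and real: "Im (h_map T \<psi> z) = 0"
  shows "Im z = 0"
proof (rule ccontr)
  assume nz: "Im z \<noteq> 0"
  define v where "v = of_real pi * z / of_real T"
  define w where "w = g_map T z / of_real T"
  have "w = (sin (v / 2))\<^sup>2"
    using T by (simp add: w_def g_map_def v_def mult.commute)
  then have "w = (1 - cos v) / 2"
    using cos_double_sin[of "v / 2"] by simp
  then have "Im w = - Im (cos v) / 2"
    by (simp only: Im_divide_numeral minus_complex.sel one_complex.sel) simp
  then have "Im w = sin (Re v) * (exp (Im v) - exp (- Im v)) / 4"
    by (simp add: Im_cos field_simps)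
  moreover have "0 < sin (Re v)"
    using z T by (intro sin_gt_zero) (auto simp: v_def vert_strip_def field_simps)
  moreover have "Im v \<noteq> 0" using nz T by (simp add: v_def)
  ultimately have "Im w \<noteq> 0" by (auto simp: mult_eq_0_iff)
  then have "Im (contour_integral (linepath 0 w)
      (\<lambda>t. t powr of_real (\<psi> / pi - 1) * (1 - t) powr of_real (- (\<psi> / pi)))) \<noteq> 0"
    using \<psi> by (intro Im_contour_integral_incomplete_beta) (auto simp: field_simps)
  moreover have "h_map T \<psi> z = of_real (T * sin \<psi> / pi) * contour_integral (linepath 0 w)
      (\<lambda>t. t powr of_real (\<psi> / pi - 1) * (1 - t) powr of_real (- (\<psi> / pi)))"
    by (simp add: h_map_def f_map_def w_def)
  moreover have "T * sin \<psi> / pi \<noteq> 0"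
    using T \<psi> sin_gt_zero[of \<psi>] by simp
  ultimately show False using real by (simp only: Im_complex_of_real Re_complex_of_real times_complex.simps) simp
qed

text \<open>The intermediate value theorem along the real axis gives a preimage. It places
  \<open>t\<close> in the first branch of \<open>h_inv\<close>, so the boundary limit never has to
  be evaluated.\<close>

lemma of_real_in_h_map_image:
  assumes T: "T > 0" and \<psi>: "0 < \<psi>" "\<psi> < pi" and t: "0 \<le> t" "t \<le> T"
  shows "of_real t \<in> h_map T \<psi> ` (vert_strip T \<union> {0, of_real T})"
proof -
  define H where "H = (\<lambda>x. T * sin \<psi> / pi * incomplete_beta (\<psi> / pi) ((sin (pi * x / (2 * T)))\<^sup>2))"
  have "continuous_on {0..T} (\<lambda>x. incomplete_beta (\<psi> / pi) ((sin (pi * x / (2 * T)))\<^sup>2))"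
    by (rule continuous_on_compose2[OF continuous_on_incomplete_beta])
       (use \<psi> T in \<open>auto intro!: continuous_intros simp: abs_square_le_1\<close>)
  then have "continuous_on {0..T} H" unfolding H_def by (intro continuous_intros)
  moreover have "H 0 = 0" by (simp add: H_def)
  \<comment> \<open>The factor \<open>sin \<psi> / pi\<close> cancels the complete integral
    \<open>pi / sin \<psi>\<close>.\<close>
  moreover have "H T = T"
    using T \<psi> sin_gt_zero[of \<psi>] by (simp add: H_def incomplete_beta_1)
  ultimately obtain x where x: "0 \<le> x" "x \<le> T" "H x = t"
    using IVT'[of H 0 t T] t T by auto
  have "h_map T \<psi> (of_real x) = of_real t"
    using h_map_of_real[OF T \<psi>, of x] x(3) by (simp only: H_def)
  moreover have "of_real x \<in> vert_strip T \<union> {0, complex_of_real T}"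
    using x by (auto simp: vert_strip_def)
  ultimately show ?thesis by (metis imageI)
qed

section \<open>The lower bound for w\<close>

theorem lemma2:
  fixes T \<psi> :: real
  assumes "T > 0" and "0 < \<psi>" and "\<psi> \<le> pi / 2"
  shows "\<forall>t::real. 0 < t \<and> t \<le> T \<longrightarrow>
    w_fun T \<psi> (of_real t) \<ge>
      2 / pi * (\<psi> / sin \<psi>) powr (pi / (2 * \<psi>)) * (t / T) powr (pi / (2 * \<psi>))"
proof (intro allI impI)
  fix t :: real assume t: "0 < t \<and> t \<le> T"
  have \<psi>_lt: "\<psi> < pi" using assms by linarith
  have sin_pos: "0 < sin \<psi>" using assms \<psi>_lt by (intro sin_gt_zero)
  define z where "z = h_inv T \<psi> (of_real t)"
  have img: "of_real t \<in> h_map T \<psi> ` (vert_strip T \<union> {0, of_real T})"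
    using t assms \<psi>_lt by (intro of_real_in_h_map_image) auto
  then have z: "z \<in> vert_strip T \<union> {0, of_real T}" "h_map T \<psi> z = of_real t"
    unfolding z_def h_inv_def using inv_into_into[OF img] f_inv_into_f[OF img] by simp_all
  then have "Im z = 0"
    using h_map_real_imp_real[OF assms, of z] by auto
  define x where "x = Re z"
  have zx: "z = of_real x" using \<open>Im z = 0\<close> by (simp add: x_def complex_eq_iff)
  have x: "0 \<le> x" "x \<le> T" using z(1) assms by (auto simp: x_def vert_strip_def)
  define p where "p = pi * x / (2 * T)"
  have p: "0 \<le> p" "p \<le> pi / 2" using x assms by (auto simp: p_def field_simps)
  have "t = T * sin \<psi> / pi * incomplete_beta (\<psi> / pi) ((sin p)\<^sup>2)"
    using z(2) h_map_of_real[OF assms(1,2) \<psi>_lt, of x] unfolding zx p_def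
    by (simp only: of_real_eq_iff)
  \<comment> \<open>Scaling by \<open>\<psi> / sin \<psi>\<close> turns the prefactor into
    \<open>a = \<psi> / pi\<close>, the form of the Beta estimate.\<close>
  then have "\<psi> / sin \<psi> * (t / T) = \<psi> / pi * incomplete_beta (\<psi> / pi) ((sin p)\<^sup>2)"
    using sin_pos assms by simp
  also have "\<dots> \<le> p powr (2 * (\<psi> / pi))"
    using assms p by (intro incomplete_beta_sin_squared_le) (auto simp: field_simps)
  finally have le: "\<psi> / sin \<psi> * (t / T) \<le> p powr (2 * (\<psi> / pi))" .
  \<comment> \<open>The exponent \<open>pi / (2 * \<psi>)\<close> is the reciprocal of
    \<open>2 * (\<psi> / pi)\<close>, so raising the estimate to it isolates
    \<open>p\<close>.\<close>
  have "(\<psi> / sin \<psi>) powr (pi / (2 * \<psi>)) * (t / T) powr (pi / (2 * \<psi>)) =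
        (\<psi> / sin \<psi> * (t / T)) powr (pi / (2 * \<psi>))"
    using assms sin_pos t by (subst powr_mult) auto
  also have "\<dots> \<le> (p powr (2 * (\<psi> / pi))) powr (pi / (2 * \<psi>))"
    using assms sin_pos t le by (intro powr_mono2) auto
  also have "\<dots> = p" using assms p by (simp add: powr_powr)
  finally have "2 / pi * ((\<psi> / sin \<psi>) powr (pi / (2 * \<psi>)) * (t / T) powr (pi / (2 * \<psi>))) \<le> 2 / pi * p"
    by (intro mult_left_mono) auto
  \<comment> \<open>By the choice of \<open>p\<close>, the product \<open>2 / pi * p\<close> is
    \<open>x / T\<close>.\<close>
  also have "\<dots> = w_fun T \<psi> (of_real t)"
    by (simp add: w_fun_def p_def x_def flip: z_def)
  finally show "w_fun T \<psi> (of_real t) \<ge>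
      2 / pi * (\<psi> / sin \<psi>) powr (pi / (2 * \<psi>)) * (t / T) powr (pi / (2 * \<psi>))"
    by (simp add: mult.assoc)
qed

end
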